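(* There is no algorithm (deterministic or zero-error randomized) for the Search on Trees problem that has expected query complexity $o(k\log \mathrm{dist}(s,t))$ for every tree $T=(V,E)$ of pathwidth $k$, every prediction $s\in V$, and every target $t\in V$.
   Context: Search on Trees problem: we are given a finite tree $T=(V,E)$ and a prediction $s\in V$; there is an unknown target $t\in V$. The algorithm may adaptively query any node $x\in V$; the query returns "here" if $x=t$, and otherwise returns the unique neighbor of $x$ lying on the path in $T$ from $x$ to $t$. The algorithm must always output the correct target; its query complexity on a given input is the number of queries (for randomized algorithms, the expectation over internal randomness). $\mathrm{dist}(s,t)$ is the number of edges on the $s$–$t$ path in $T$. Pathwidth: a path decomposition of a graph $G$ is a sequence of vertex sets $B_1,\dots,B_m$ covering $V(G)$ such that every edge lies inside some $B_i$ and for every vertex $v$ the set $\{i:v\in B_i\}$ is an interval; the pathwidth is the minimum over decompositions of $\max_i|B_i|-1$. *)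

theory Defs
  imports "HOL-Probability.Probability" "HOL-Library.Landau_Symbols"
begin

section \<open>Finite trees\<close>

type_synonym 'v graph = "'v set \<times> 'v set set"

abbreviation verts :: "'v graph \<Rightarrow> 'v set" where "verts \<equiv> fst"
abbreviation edges :: "'v graph \<Rightarrow> 'v set set" where "edges \<equiv> snd"

definition finite_simple_graph :: "'v graph \<Rightarrow> bool" where
  "finite_simple_graph G \<longleftrightarrow>
     finite (verts G) \<and> (\<forall>e\<in>edges G. e \<subseteq> verts G \<and> card e = 2)"

definition path_between :: "'v graph \<Rightarrow> 'v \<Rightarrow> 'v list \<Rightarrow> 'v \<Rightarrow> bool" where
  "path_between G x p y \<longleftrightarrow>
     p \<noteq> [] \<and> hd p = x \<and> last p = y \<and> set p \<subseteq> verts G \<and> distinct p \<and>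
     successively (\<lambda>u v. {u, v} \<in> edges G) p"

definition is_cycle :: "'v graph \<Rightarrow> 'v list \<Rightarrow> bool" where
  "is_cycle G c \<longleftrightarrow>
     length c \<ge> 3 \<and> path_between G (hd c) c (last c) \<and> {last c, hd c} \<in> edges G"

definition is_tree :: "'v graph \<Rightarrow> bool" where
  "is_tree T \<longleftrightarrow>
     finite_simple_graph T \<and> verts T \<noteq> {} \<and>
     (\<forall>x\<in>verts T. \<forall>y\<in>verts T. \<exists>p. path_between T x p y) \<and>
     (\<nexists>c. is_cycle T c)"

definition tree_path :: "'v graph \<Rightarrow> 'v \<Rightarrow> 'v \<Rightarrow> 'v list" where
  "tree_path T x y = (THE p. path_between T x p y)"

definition tree_dist :: "'v graph \<Rightarrow> 'v \<Rightarrow> 'v \<Rightarrow> nat" where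
  "tree_dist T x y = length (tree_path T x y) - 1"

section \<open>Pathwidth\<close>

definition path_decomposition :: "'v graph \<Rightarrow> 'v set list \<Rightarrow> bool" where
  "path_decomposition G Bs \<longleftrightarrow>
     \<Union>(set Bs) = verts G \<and>
     (\<forall>e\<in>edges G. \<exists>B\<in>set Bs. e \<subseteq> B) \<and>
     (\<forall>v\<in>verts G. \<exists>a b. {i. i < length Bs \<and> v \<in> Bs ! i} = {a..b})"

definition decomposition_width :: "'v set list \<Rightarrow> nat" where
  "decomposition_width Bs = Max (card ` set Bs) - 1"

text \<open>Used only for graphs with at least one vertex, where some bag is nonempty and the
  truncated subtraction above is harmless.\<close>

definition pathwidth :: "'v graph \<Rightarrow> nat" where
  "pathwidth G = (LEAST w. \<exists>Bs. path_decomposition G Bs \<and> decomposition_width Bs = w)"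

section \<open>Search on trees\<close>

datatype 'v response = Here | Toward 'v

definition respond :: "'v graph \<Rightarrow> 'v \<Rightarrow> 'v \<Rightarrow> 'v response" where
  "respond T t x =
     (if x = t then Here
      else Toward (THE y. {x, y} \<in> edges T \<and> y \<in> set (tree_path T x t)))"

text \<open>A deterministic adaptive search procedure for one given tree and prediction, as a decision
  tree. It may output a vertex that it has not queried.\<close>

datatype 'v strategy = Output 'v | Query 'v "'v response \<Rightarrow> 'v strategy"

primrec queries :: "'v graph \<Rightarrow> 'v \<Rightarrow> 'v strategy \<Rightarrow> 'v list" where
  "queries T t (Output v) = []"
| "queries T t (Query x f) = x # queries T t (f (respond T t x))"

primrec result :: "'v graph \<Rightarrow> 'v \<Rightarrow> 'v strategy \<Rightarrow> 'v" where
  "result T t (Output v) = v"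
| "result T t (Query x f) = result T t (f (respond T t x))"

definition solves :: "'v graph \<Rightarrow> 'v strategy \<Rightarrow> bool" where
  "solves T \<sigma> \<longleftrightarrow> (\<forall>t\<in>verts T. set (queries T t \<sigma>) \<subseteq> verts T \<and> result T t \<sigma> = t)"

text \<open>An algorithm receives the tree, the prediction and a sample of its internal randomness, drawn
  from the probability space \<open>M\<close>. Algorithms that ignore the sample are the deterministic ones.
  Strategies always halt; a randomized procedure that halts only almost surely is covered by
  changing it on a null set, since correctness is required almost surely.\<close>

type_synonym ('r, 'v) algorithm = "'v graph \<Rightarrow> 'v \<Rightarrow> 'r \<Rightarrow> 'v strategy"

definition num_queries :: "('r, 'v) algorithm \<Rightarrow> 'v graph \<Rightarrow> 'v \<Rightarrow> 'v \<Rightarrow> 'r \<Rightarrow> nat" where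
  "num_queries A T s t \<omega> = length (queries T t (A T s \<omega>))"

definition zero_error_algorithm :: "'r measure \<Rightarrow> ('r, 'v) algorithm \<Rightarrow> bool" where
  "zero_error_algorithm M A \<longleftrightarrow>
     prob_space M \<and>
     (\<forall>T s. is_tree T \<and> s \<in> verts T \<longrightarrow>
        (AE \<omega> in M. solves T (A T s \<omega>)) \<and>
        (\<forall>t\<in>verts T. num_queries A T s t \<in> measurable M (count_space UNIV)))"

definition expected_queries ::
    "'r measure \<Rightarrow> ('r, 'v) algorithm \<Rightarrow> 'v graph \<Rightarrow> 'v \<Rightarrow> 'v \<Rightarrow> ennreal" where
  "expected_queries M A T s t = (\<integral>\<^sup>+\<omega>. of_nat (num_queries A T s t \<omega>) \<partial>M)"

text \<open>Expected query complexity \<open>o(k log dist(s,t))\<close>. The filter \<open>F\<close> on pairs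
  (pathwidth, distance) is the limit in which the two-parameter little-o is understood.
  For \<open>F = K \<times>\<^sub>F at_top\<close> the distance tends to infinity and \<open>K\<close> describes the pathwidth:
  \<open>K = at_top\<close> is the joint limit, \<open>K = principal {k}\<close> is a fixed pathwidth, and
  \<open>K = principal {1..}\<close> is uniformity in the pathwidth.
  The bound \<open>g\<close> is compared in \<open>ennreal\<close>, so an infinite expectation is never small.\<close>

definition complexity_little_o_k_log_dist ::
    "'r measure \<Rightarrow> ('r, 'v) algorithm \<Rightarrow> (nat \<times> nat) filter \<Rightarrow> bool" where
  "complexity_little_o_k_log_dist M A F \<longleftrightarrow>
     (\<exists>g :: nat \<times> nat \<Rightarrow> real.
        g \<in> o[F](\<lambda>(k, d). real k * ln (real d)) \<and>
        (\<forall>\<^sub>F (k, d) in F. \<forall>T s t.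
           is_tree T \<and> pathwidth T = k \<and> s \<in> verts T \<and> t \<in> verts T \<and> tree_dist T s t = d \<longrightarrow>
           expected_queries M A T s t \<le> ennreal (g (k, d))))"

end

theory Submission
  imports Defs "HOL-Library.Discrete_Functions"
begin

text \<open>In a tree of bounded degree every query has boundedly many answers, so a strategy that finds
  each of \<open>n\<close> targets needs on average at least a constant times \<open>ln n\<close> queries, whatever the
  prediction. For pathwidth \<open>k\<close> there are binary trees with at least \<open>L ^ k\<close> vertices, all at
  distance at most \<open>(k + 1) * L\<close> from the root: iterated combs, where a comb of level \<open>k\<close> hangs
  combs of level \<open>k - 1\<close> along a backbone of length \<open>L\<close>. For large \<open>L\<close> the average is of order
  \<open>k * ln L\<close>, and so is \<open>k\<close> times the logarithm of the distance. As only boundedly many vertices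
  lie close to the root, the targets may be required to be far away from it.\<close>

section \<open>Paths in trees\<close>

lemma finite_verts_tree: "is_tree T \<Longrightarrow> finite (verts T)"
  by (simp add: is_tree_def finite_simple_graph_def)

lemma path_between_Cons_iff:
  "path_between G x (w # p) z \<longleftrightarrow> w = x \<and> x \<in> verts G \<and>
     (p = [] \<and> z = x \<or> x \<notin> set p \<and> {x, hd p} \<in> edges G \<and> path_between G (hd p) p z)"
  by (cases p) (auto simp: path_between_def)

lemma path_between_snoc:
  assumes "path_between G x p y" "{y, z} \<in> edges G" "z \<in> verts G" "z \<notin> set p"
  shows "path_between G x (p @ [z]) z"
  using assms by (auto simp: path_between_def successively_append_iff)

lemma path_between_rev: "path_between G x p y \<Longrightarrow> path_between G y (rev p) x"
  by (auto simp: path_between_def hd_rev last_rev insert_commute)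

lemma path_between_split_iff:
  "path_between G x (p @ z # q) y \<longleftrightarrow>
     path_between G x (p @ [z]) z \<and> path_between G z (z # q) y \<and> set p \<inter> set q = {}"
proof (induction p arbitrary: x)
  case Nil
  show ?case by (auto simp: path_between_Cons_iff)
next
  case (Cons w p)
  have hd_eq: "hd (p @ z # q) = hd (p @ [z])" by (cases p) simp_all
  have "z \<notin> set q" if "path_between G z (z # q) y"
    using that by (auto simp: path_between_Cons_iff)
  then show ?case
    unfolding append_Cons path_between_Cons_iff[of _ _ w] hd_eq Cons.IH by auto
qed

lemma path_between_trans:
  assumes p: "path_between G x p y" and q: "path_between G y q z"
  obtains r where "path_between G x r z" "set r \<subseteq> set p \<union> set q"
proof -
  have "\<exists>w\<in>set p. w \<in> set q"
    using p q by (metis hd_in_set last_in_set path_between_def)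
  then obtain p\<^sub>1 w p\<^sub>2 where p_split: "p = p\<^sub>1 @ w # p\<^sub>2" and "w \<in> set q"
    and first: "\<forall>v\<in>set p\<^sub>1. v \<notin> set q"
    using split_list_first_prop[of p "\<lambda>w. w \<in> set q"] by blast
  then obtain q\<^sub>1 q\<^sub>2 where q_split: "q = q\<^sub>1 @ w # q\<^sub>2" by (meson split_list)
  have "path_between G x (p\<^sub>1 @ w # q\<^sub>2) z"
    using p q first path_between_split_iff[of G x p\<^sub>1 w p\<^sub>2 y]
      path_between_split_iff[of G y q\<^sub>1 w q\<^sub>2 z] path_between_split_iff[of G x p\<^sub>1 w q\<^sub>2 z]
    by (auto simp: p_split q_split)
  then show thesis by (rule that) (auto simp: p_split q_split)
qed

lemma path_between_mono:
  assumes "path_between H x p y" "verts H \<subseteq> verts G" "edges H \<subseteq> edges G"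
  shows "path_between G x p y"
  using assms unfolding path_between_def by (auto elim: successively_mono)

lemma is_cycle_Cons:
  assumes "path_between G a p b" "a \<noteq> b" "x \<in> verts G" "x \<notin> set p"
    and "{x, a} \<in> edges G" "{x, b} \<in> edges G"
  shows "is_cycle G (x # p)"
proof -
  have "p \<noteq> []" "hd p = a" "last p = b" using assms(1) by (auto simp: path_between_def)
  moreover from this have "length p \<ge> 2"
    using assms(2) by (cases p; cases "tl p") auto
  ultimately show ?thesis
    using assms by (auto simp: is_cycle_def path_between_Cons_iff insert_commute)
qed

lemma path_between_unique:
  assumes "\<nexists>c. is_cycle G c"
  shows "path_between G x p y \<Longrightarrow> path_between G x q y \<Longrightarrow> p = q"
proof (induction p arbitrary: x q)
  case Nil
  then show ?case by (simp add: path_between_def)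
next
  case (Cons w p)
  obtain q' where q: "q = x # q'"
    using Cons.prems(2) by (cases q) (auto simp: path_between_def)
  show ?case
  proof (cases "p = [] \<or> q' = []")
    case True
    then show ?thesis
      using Cons.prems unfolding q
      by (auto simp: path_between_Cons_iff) (auto simp: path_between_def)
  next
    case False
    then have p_tail: "x \<notin> set p" "{x, hd p} \<in> edges G" "path_between G (hd p) p y"
      and q_tail: "x \<notin> set q'" "{x, hd q'} \<in> edges G" "path_between G (hd q') q' y"
      and "w = x" "x \<in> verts G"
      using Cons.prems by (auto simp: q path_between_Cons_iff)
    obtain r where r: "path_between G (hd p) r (hd q')" "set r \<subseteq> set p \<union> set q'"
      using path_between_trans[OF p_tail(3) path_between_rev[OF q_tail(3)]] by auto
    have "x \<notin> set r" using r(2) p_tail(1) q_tail(1) by blast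
    then have "hd p = hd q'"
      using is_cycle_Cons[OF r(1) _ \<open>x \<in> verts G\<close>] p_tail(2) q_tail(2) assms by blast
    then show ?thesis using Cons.IH[OF p_tail(3)] q_tail(3) by (simp add: q \<open>w = x\<close>)
  qed
qed

lemma tree_path_eqI:
  assumes "is_tree T" "path_between T x p y"
  shows "tree_path T x y = p"
proof -
  have "\<nexists>c. is_cycle T c" using assms(1) by (simp add: is_tree_def)
  then show ?thesis
    unfolding tree_path_def using assms(2) path_between_unique by (metis the_equality)
qed

lemma cycle_vertex_neighbours:
  assumes "is_cycle G c" "v \<in> set c"
  obtains a b where "a \<noteq> b" "a \<in> set c" "b \<in> set c" "{v, a} \<in> edges G" "{v, b} \<in> edges G"
proof -
  obtain xs ys where c: "c = xs @ v # ys" using assms(2) by (meson split_list)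
  have succ: "successively (\<lambda>u v. {u, v} \<in> edges G) (xs @ v # ys)" and "distinct (ys @ xs)"
    and len: "length (ys @ xs) \<ge> 2"
    and closing: "{last (xs @ v # ys), hd (xs @ v # ys)} \<in> edges G"
    using assms(1) unfolding c by (auto simp: is_cycle_def path_between_def)
  have ne: "ys @ xs \<noteq> []" using len by auto
  let ?next = "hd (ys @ xs)" and ?prev = "last (ys @ xs)"
  have "?next \<noteq> ?prev"
    using \<open>distinct _\<close> len by (cases "ys @ xs"; cases "tl (ys @ xs)") auto
  moreover have "?next \<in> set c" "?prev \<in> set c"
    using hd_in_set[OF ne] last_in_set[OF ne] by (auto simp: c)
  moreover have "{v, ?next} \<in> edges G"
    using succ closing ne
    by (cases "ys = []") (auto simp: successively_append_iff successively_Cons)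
  moreover have "{v, ?prev} \<in> edges G"
    using succ closing ne
    by (cases "xs = []") (auto simp: successively_append_iff insert_commute)
  ultimately show thesis by (rule that)
qed

section \<open>The number of queries on average\<close>

definition neighbours :: "'v graph \<Rightarrow> 'v \<Rightarrow> 'v set" where
  "neighbours G x = {y. {x, y} \<in> edges G}"

lemma neighbours_subset_verts: "finite_simple_graph G \<Longrightarrow> neighbours G x \<subseteq> verts G"
  by (auto simp: finite_simple_graph_def neighbours_def)

lemma respond_eq_Toward:
  assumes T: "is_tree T" and "x \<in> verts T" "t \<in> verts T" "x \<noteq> t"
  shows "\<exists>y\<in>neighbours T x. respond T t x = Toward y"
proof -
  obtain q where q: "path_between T x q t"
    using assms unfolding is_tree_def by blast
  then obtain p where "q = x # p" by (cases q) (auto simp: path_between_def)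
  moreover from this have "p \<noteq> []"
    using q \<open>x \<noteq> t\<close> by (auto simp: path_between_def)
  ultimately have p: "p \<noteq> []" "x \<notin> set p" "{x, hd p} \<in> edges T" "path_between T (hd p) p t"
    using q by (simp_all add: path_between_Cons_iff)
  have "(THE y. {x, y} \<in> edges T \<and> y \<in> set (x # p)) = hd p"
  proof (rule the_equality)
    show "{x, hd p} \<in> edges T \<and> hd p \<in> set (x # p)" using p by simp
  next
    fix y assume y: "{x, y} \<in> edges T \<and> y \<in> set (x # p)"
    then have "card {x, y} = 2" using T by (simp add: is_tree_def finite_simple_graph_def)
    then obtain p\<^sub>1 p\<^sub>2 where split: "p = p\<^sub>1 @ y # p\<^sub>2" using y by (auto dest: split_list)
    then have "path_between T (hd p) (p\<^sub>1 @ [y]) y"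
      using p(4) path_between_split_iff by metis
    moreover have "x \<notin> set (p\<^sub>1 @ [y])" using p(2) by (simp add: split)
    moreover have "\<nexists>c. is_cycle T c" using T by (simp add: is_tree_def)
    ultimately show "y = hd p"
      using is_cycle_Cons[of T "hd p" "p\<^sub>1 @ [y]" y x] p(3) y assms(2) by blast
  qed
  then have "respond T t x = Toward (hd p)"
    using tree_path_eqI[OF T q] \<open>x \<noteq> t\<close> by (simp add: respond_def \<open>q = x # p\<close>)
  then show ?thesis using p(3) by (auto simp: neighbours_def)
qed

definition responses :: "'v graph \<Rightarrow> 'v \<Rightarrow> 'v response set" where
  "responses T x = (\<lambda>t. respond T t x) ` verts T"

lemma card_responses_le:
  assumes "is_tree T" "x \<in> verts T"
  shows "card (responses T x) \<le> Suc (card (neighbours T x))"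
proof -
  have fin: "finite (neighbours T x)"
    using finite_verts_tree[OF assms(1)] neighbours_subset_verts[of T x] assms(1)
    by (auto simp: is_tree_def intro: finite_subset)
  have "responses T x \<subseteq> insert Here (Toward ` neighbours T x)"
    using respond_eq_Toward[OF assms] by (force simp: responses_def respond_def)
  then have "card (responses T x) \<le> card (insert Here (Toward ` neighbours T x))"
    using fin by (intro card_mono) auto
  also have "\<dots> \<le> Suc (card (Toward ` neighbours T x))"
    by (rule card_insert_le_m1) simp_all
  also have "\<dots> \<le> Suc (card (neighbours T x))" using fin by (simp add: card_image_le)
  finally show ?thesis .
qed

lemma sum_fibres_le:
  fixes w :: "'a \<Rightarrow> real"
  assumes "finite S" "\<And>y. y \<in> f ` S \<Longrightarrow> (\<Sum>x | x \<in> S \<and> f x = y. w x) \<le> c"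
  shows "sum w S \<le> real (card (f ` S)) * c"
proof -
  have "sum w S = (\<Sum>y\<in>f ` S. \<Sum>x | x \<in> S \<and> f x = y. w x)"
    using assms(1) by (intro sum.group[symmetric]) auto
  also have "\<dots> \<le> real (card (f ` S)) * c" using assms(2) by (rule sum_bounded_above)
  finally show ?thesis .
qed

lemma kraft_inequality_queries:
  assumes fin: "finite (verts T)"
    and resp: "\<And>x. x \<in> verts T \<Longrightarrow> card (responses T x) \<le> b"
    and "S \<subseteq> verts T" "\<And>t. t \<in> S \<Longrightarrow> set (queries T t \<sigma>) \<subseteq> verts T \<and> result T t \<sigma> = t"
  shows "(\<Sum>t\<in>S. (1 / real b) ^ length (queries T t \<sigma>)) \<le> 1"
  using assms(3,4)
proof (induction \<sigma> arbitrary: S)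
  case (Output v)
  then have "S \<subseteq> {v}" by auto
  then show ?case by (auto simp: subset_singleton_iff)
next
  case (Query x f)
  let ?w = "\<lambda>t. (1 / real b) ^ length (queries T t (Query x f))"
  show ?case
  proof (cases "S = {}")
    case False
    then have x: "x \<in> verts T" using Query.prems(2) by auto
    have "(\<Sum>t\<in>S. ?w t) \<le> real (card ((\<lambda>t. respond T t x) ` S)) * (1 / real b)"
    proof (rule sum_fibres_le)
      show "finite S" using fin Query.prems(1) by (rule rev_finite_subset)
      fix \<rho>
      let ?S = "{t \<in> S. respond T t x = \<rho>}"
      have "(\<Sum>t\<in>?S. ?w t) = 1 / real b * (\<Sum>t\<in>?S. (1 / real b) ^ length (queries T t (f \<rho>)))"
        unfolding sum_distrib_left by (rule sum.cong) auto
      also have "(\<Sum>t\<in>?S. (1 / real b) ^ length (queries T t (f \<rho>))) \<le> 1"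
        using Query.prems by (intro Query.IH) fastforce+
      finally show "(\<Sum>t\<in>?S. ?w t) \<le> 1 / real b" by (simp add: mult_left_mono divide_right_mono)
    qed
    also have "card ((\<lambda>t. respond T t x) ` S) \<le> card (responses T x)"
      using fin Query.prems(1) unfolding responses_def by (intro card_mono image_mono) auto
    also have "real (card (responses T x)) * (1 / real b) \<le> 1"
      using resp[OF x] by (cases "b = 0") simp_all
    finally show ?thesis by (simp add: mult_right_mono divide_right_mono)
  qed simp
qed

text \<open>Jensen's inequality for Kraft's sum, in the form \<open>1 + y \<le> exp y\<close> with
  \<open>y = ln |S| - len t * ln b\<close>.\<close>

lemma sum_queries_ge:
  assumes "finite (verts T)"
    and "\<And>x. x \<in> verts T \<Longrightarrow> card (responses T x) \<le> b"
    and "S \<subseteq> verts T" "solves T \<sigma>" "1 < b"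
  shows "real (card S) * log (real b) (real (card S)) \<le> (\<Sum>t\<in>S. real (length (queries T t \<sigma>)))"
proof (cases "S = {}")
  case False
  let ?n = "real (card S)" and ?len = "\<lambda>t. real (length (queries T t \<sigma>))"
  have n: "?n > 0" using False assms(1,3) by (simp add: card_gt_0_iff finite_subset)
  have b: "real b > 1" "ln (real b) > 0" using assms(5) by auto
  have "(\<Sum>t\<in>S. 1 + (ln ?n - ?len t * ln (real b))) \<le> (\<Sum>t\<in>S. exp (ln ?n - ?len t * ln (real b)))"
    by (intro sum_mono exp_ge_add_one_self)
  also have "\<dots> = ?n * (\<Sum>t\<in>S. (1 / real b) ^ length (queries T t \<sigma>))"
    unfolding sum_distrib_left
    using n b by (intro sum.cong) (auto simp: exp_diff exp_of_nat_mult power_divide)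
  also have "\<dots> \<le> ?n * 1"
    using assms by (intro mult_left_mono kraft_inequality_queries) (auto simp: solves_def)
  finally have "?n * ln ?n \<le> (\<Sum>t\<in>S. ?len t) * ln (real b)"
    by (simp add: sum.distrib sum_subtractf sum_distrib_right distrib_left)
  then show ?thesis using b by (simp add: log_def field_simps)
qed simp

lemma sum_expected_queries_ge:
  assumes alg: "zero_error_algorithm M A" and T: "is_tree T" "s \<in> verts T"
    and resp: "\<And>x. x \<in> verts T \<Longrightarrow> card (responses T x) \<le> b"
    and S: "S \<subseteq> verts T" and b: "1 < b"
  shows "ennreal (real (card S) * log (real b) (real (card S)))
    \<le> (\<Sum>t\<in>S. expected_queries M A T s t)"
proof -
  interpret prob_space M using alg by (simp add: zero_error_algorithm_def)
  let ?bound = "real (card S) * log (real b) (real (card S))"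
  have fin: "finite (verts T)" using T(1) by (rule finite_verts_tree)
  have correct: "AE \<omega> in M. solves T (A T s \<omega>)"
    and meas: "\<And>t. t \<in> S \<Longrightarrow> num_queries A T s t \<in> measurable M (count_space UNIV)"
    using alg T S unfolding zero_error_algorithm_def by blast+
  have "ennreal ?bound = (\<integral>\<^sup>+\<omega>. ennreal ?bound \<partial>M)" by (simp add: emeasure_space_1)
  also have "\<dots> \<le> (\<integral>\<^sup>+\<omega>. (\<Sum>t\<in>S. of_nat (num_queries A T s t \<omega>)) \<partial>M)"
  proof (rule nn_integral_mono_AE, use correct in eventually_elim)
    fix \<omega> assume "solves T (A T s \<omega>)"
    then have "?bound \<le> (\<Sum>t\<in>S. real (num_queries A T s t \<omega>))"
      using sum_queries_ge[OF fin resp S _ b] by (simp add: num_queries_def)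
    then show "ennreal ?bound \<le> (\<Sum>t\<in>S. of_nat (num_queries A T s t \<omega>))"
      by (metis ennreal_leI ennreal_of_nat_eq_real_of_nat of_nat_sum)
  qed
  also have "\<dots> = (\<Sum>t\<in>S. expected_queries M A T s t)"
    unfolding expected_queries_def
    using measurable_compose[OF meas, of _ of_nat borel] by (intro nn_integral_sum) simp
  finally show ?thesis .
qed

lemma exists_expected_queries_ge:
  assumes alg: "zero_error_algorithm M A" and T: "is_tree T" "s \<in> verts T"
    and degree: "\<And>x. x \<in> verts T \<Longrightarrow> card (neighbours T x) \<le> d" and "1 \<le> d"
    and S: "S \<subseteq> verts T" "S \<noteq> {}"
  shows "\<exists>t\<in>S. ennreal (log (real (Suc d)) (real (card S))) \<le> expected_queries M A T s t"
proof -
  let ?E = "expected_queries M A T s" and ?bound = "log (real (Suc d)) (real (card S))"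
  have "finite S" using finite_verts_tree[OF T(1)] S(1) by (rule rev_finite_subset)
  then have "card S > 0" using S(2) by (simp add: card_gt_0_iff)
  obtain t where t: "t \<in> S" "Max (?E ` S) = ?E t" using \<open>finite S\<close> S(2) by (rule obtains_MAX)
  have "of_nat (card S) * ennreal ?bound = ennreal (real (card S) * ?bound)"
    by (simp add: ennreal_mult' ennreal_of_nat_eq_real_of_nat)
  also have "\<dots> \<le> sum ?E S"
    using sum_expected_queries_ge[OF alg T _ S(1), of "Suc d"]
      card_responses_le[OF T(1)] degree \<open>1 \<le> d\<close> by (meson Suc_le_mono le_imp_less_Suc order.trans)
  also have "\<dots> \<le> of_nat (card S) * ?E t"
    unfolding t(2)[symmetric] using \<open>finite S\<close> by (intro sum_bounded_above Max_ge) simp_all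
  finally have "ennreal ?bound \<le> ?E t"
    using \<open>card S > 0\<close> by (simp add: ennreal_mult_le_mult_iff)
  then show ?thesis using t(1) by blast
qed

section \<open>Path decompositions\<close>

lemma path_decomposition_Union: "path_decomposition G Bs \<Longrightarrow> \<Union>(set Bs) = verts G"
  by (simp add: path_decomposition_def)

lemma path_decomposition_edge_in_bag:
  "path_decomposition G Bs \<Longrightarrow> e \<in> edges G \<Longrightarrow> \<exists>B\<in>set Bs. e \<subseteq> B"
  by (simp add: path_decomposition_def)

lemma path_decomposition_bag_convex:
  assumes "path_decomposition G Bs" "i \<le> j" "j \<le> m" "m < length Bs" "v \<in> Bs ! i" "v \<in> Bs ! m"
  shows "v \<in> Bs ! j"
proof -
  have "Bs ! i \<in> set Bs" using assms by simp
  then have "v \<in> verts G" using path_decomposition_Union[OF assms(1)] assms(5) by blast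
  then obtain a b where occ: "{i. i < length Bs \<and> v \<in> Bs ! i} = {a..b}"
    using assms(1) unfolding path_decomposition_def by blast
  have "i \<in> {a..b}" "m \<in> {a..b}" unfolding occ[symmetric] using assms(2-6) by simp_all
  then have "j \<in> {a..b}" using assms(2,3) by simp
  then show ?thesis unfolding occ[symmetric] by simp
qed

lemma path_decomposition_in_bag_if_in_last:
  assumes "path_decomposition G Bs" "i \<le> j" "j < length Bs" "v \<in> Bs ! i" "v \<in> last Bs"
  shows "v \<in> Bs ! j"
proof -
  have "v \<in> Bs ! (length Bs - 1)"
    using assms(3,5) last_conv_nth[of Bs] by (cases Bs) auto
  then show ?thesis
    using assms(3) by (intro path_decomposition_bag_convex[OF assms(1,2) _ _ assms(4)]) auto
qed

lemma path_decomposition_in_bag_if_in_hd: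
  assumes "path_decomposition G Bs" "j \<le> m" "m < length Bs" "v \<in> hd Bs" "v \<in> Bs ! m"
  shows "v \<in> Bs ! j"
proof -
  have "v \<in> Bs ! 0" using assms(3,4) hd_conv_nth[of Bs] by (cases Bs) auto
  then show ?thesis
    using path_decomposition_bag_convex[OF assms(1) _ assms(2,3) _ assms(5)] by blast
qed

lemma path_decompositionI:
  assumes "\<Union>(set Bs) = verts G" and "\<And>e. e \<in> edges G \<Longrightarrow> \<exists>B\<in>set Bs. e \<subseteq> B"
    and convex: "\<And>v i j m. i \<le> j \<Longrightarrow> j \<le> m \<Longrightarrow> m < length Bs \<Longrightarrow> v \<in> Bs ! i \<Longrightarrow> v \<in> Bs ! m
      \<Longrightarrow> v \<in> Bs ! j"
  shows "path_decomposition G Bs"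
  unfolding path_decomposition_def
proof (intro conjI ballI)
  fix v assume "v \<in> verts G"
  let ?I = "{i. i < length Bs \<and> v \<in> Bs ! i}"
  have "finite ?I" by simp
  obtain B where "B \<in> set Bs" "v \<in> B" using \<open>v \<in> verts G\<close> assms(1) by blast
  then have "?I \<noteq> {}" by (auto simp: in_set_conv_nth)
  define a b where "a = Min ?I" and "b = Max ?I"
  have "a \<in> ?I" "b \<in> ?I"
    unfolding a_def b_def by (rule Min_in Max_in; fact)+
  then have "{a..b} \<subseteq> ?I" using convex[of a _ b v] by auto
  moreover have "?I \<subseteq> {a..b}"
    unfolding a_def b_def using \<open>finite ?I\<close> by (meson Max_ge Min_le atLeastAtMost_iff subsetI)
  ultimately show "\<exists>a b. ?I = {a..b}" by blast
qed (use assms in auto)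

lemma path_decomposition_append:
  assumes Bs: "path_decomposition G Bs" and Cs: "path_decomposition H Cs"
    and common: "verts G \<inter> verts H \<subseteq> last Bs \<inter> hd Cs"
  shows "path_decomposition (verts G \<union> verts H, edges G \<union> edges H) (Bs @ Cs)"
proof (rule path_decompositionI)
  show "\<Union>(set (Bs @ Cs)) = verts (verts G \<union> verts H, edges G \<union> edges H)"
    by (simp add: path_decomposition_Union[OF Bs] path_decomposition_Union[OF Cs])
  show "\<exists>B\<in>set (Bs @ Cs). e \<subseteq> B"
    if "e \<in> edges (verts G \<union> verts H, edges G \<union> edges H)" for e
    using that path_decomposition_edge_in_bag[OF Bs, of e]
      path_decomposition_edge_in_bag[OF Cs, of e] by auto
next
  fix v i j m
  assume ijm: "i \<le> j" "j \<le> m" "m < length (Bs @ Cs)"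
    and v: "v \<in> (Bs @ Cs) ! i" "v \<in> (Bs @ Cs) ! m"
  let ?n = "length Bs"
  consider "m < ?n" | "?n \<le> i" | "i < ?n" "?n \<le> m" by linarith
  then show "v \<in> (Bs @ Cs) ! j"
  proof cases
    case 1
    then show ?thesis
      using path_decomposition_bag_convex[OF Bs ijm(1,2)] ijm v by (simp add: nth_append)
  next
    case 2
    then show ?thesis
      using path_decomposition_bag_convex[OF Cs, of "i - ?n" "j - ?n" "m - ?n" v] ijm v
      by (simp add: nth_append diff_le_mono)
  next
    case 3
    then have vi: "v \<in> Bs ! i" and vm: "v \<in> Cs ! (m - ?n)" and m: "m - ?n < length Cs"
      using v ijm by (simp_all add: nth_append)
    then have "v \<in> verts G \<inter> verts H"
      using path_decomposition_Union[OF Bs] path_decomposition_Union[OF Cs] 3(1) nth_mem by blast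
    then have "v \<in> last Bs" "v \<in> hd Cs" using common by blast+
    then show ?thesis
      using path_decomposition_in_bag_if_in_last[OF Bs ijm(1) _ vi]
        path_decomposition_in_bag_if_in_hd[OF Cs _ m _ vm, of "j - ?n"] ijm(2)
      by (simp add: nth_append diff_le_mono)
  qed
qed

lemma path_decomposition_insert:
  assumes Bs: "path_decomposition G Bs" and "Bs \<noteq> []"
  shows "path_decomposition (insert r (verts G), edges G \<union> {{r, v} | v. v \<in> verts G})
    (map (insert r) Bs)"
proof (rule path_decompositionI)
  note union = path_decomposition_Union[OF Bs]
  then show "\<Union>(set (map (insert r) Bs))
      = verts (insert r (verts G), edges G \<union> {{r, v} | v. v \<in> verts G})"
    using \<open>Bs \<noteq> []\<close> by (cases Bs) auto
  fix e assume "e \<in> edges (insert r (verts G), edges G \<union> {{r, v} | v. v \<in> verts G})"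
  then consider "e \<in> edges G" | v where "e = {r, v}" "v \<in> verts G" by auto
  then have "\<exists>B\<in>set Bs. e \<subseteq> insert r B"
  proof cases
    case 1
    from path_decomposition_edge_in_bag[OF Bs this] show ?thesis by auto
  next
    case 2
    then obtain B where "B \<in> set Bs" "v \<in> B" using union by blast
    then show ?thesis using 2 by blast
  qed
  then show "\<exists>B\<in>set (map (insert r) Bs). e \<subseteq> B" by simp
next
  fix v i j m
  assume ijm: "i \<le> j" "j \<le> m" "m < length (map (insert r) Bs)"
    and v: "v \<in> map (insert r) Bs ! i" "v \<in> map (insert r) Bs ! m"
  then show "v \<in> map (insert r) Bs ! j"
    using path_decomposition_bag_convex[OF Bs ijm(1,2), of v] by auto
qed

lemma path_decomposition_trivial:
  "(\<And>e. e \<in> edges G \<Longrightarrow> e \<subseteq> verts G) \<Longrightarrow> path_decomposition G [verts G]"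
  by (rule path_decompositionI) auto

lemma path_decomposition_mono_edges:
  assumes "path_decomposition G Bs" "verts H = verts G" "edges H \<subseteq> edges G"
  shows "path_decomposition H Bs"
  using assms by (auto simp: path_decomposition_def)

lemma pathwidth_eqI:
  assumes "path_decomposition G Bs" "\<And>B. B \<in> set Bs \<Longrightarrow> card B \<le> Suc k"
    and lower: "\<And>Cs. path_decomposition G Cs \<Longrightarrow> \<exists>C\<in>set Cs. Suc k \<le> card C"
  shows "pathwidth G = k"
proof -
  have ge: "k \<le> decomposition_width Cs" if "path_decomposition G Cs" for Cs
  proof -
    obtain C where "C \<in> set Cs" "Suc k \<le> card C" using lower \<open>path_decomposition G Cs\<close> by blast
    note \<open>Suc k \<le> card C\<close>
    also have "card C \<le> Max (card ` set Cs)" using \<open>C \<in> set Cs\<close> by (intro Max_ge) simp_all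
    finally have "Suc k \<le> Max (card ` set Cs)" .
    then show ?thesis by (simp add: decomposition_width_def)
  qed
  have "set Bs \<noteq> {}" using lower[OF assms(1)] by auto
  then have "Max (card ` set Bs) \<le> Suc k" using assms(2) by simp
  then have "decomposition_width Bs = k"
    using ge[OF assms(1)] by (simp add: decomposition_width_def)
  then show ?thesis
    unfolding pathwidth_def using assms(1) ge by (intro Least_equality) blast+
qed

lemma path_meets_bag_between:
  assumes pd: "path_decomposition G Bs" and j: "j \<le> m" "m < length Bs"
  shows "path_between G x p y \<Longrightarrow> x \<in> Bs ! i \<Longrightarrow> i \<le> j \<Longrightarrow> y \<in> Bs ! m \<Longrightarrow> Bs ! j \<inter> set p \<noteq> {}"
proof (induction p arbitrary: x i)
  case Nil
  then show ?case by (simp add: path_between_def)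
next
  case (Cons w p)
  have "w = x" using Cons.prems(1) by (simp add: path_between_Cons_iff)
  show ?case
  proof (cases "p = []")
    case True
    then have "x = y" using Cons.prems(1) by (auto simp: path_between_def)
    then show ?thesis
      using path_decomposition_bag_convex[OF pd _ j] Cons.prems(2-4) \<open>w = x\<close> by auto
  next
    case False
    then have edge: "{x, hd p} \<in> edges G" and tail: "path_between G (hd p) p y"
      using Cons.prems(1) by (auto simp: path_between_Cons_iff)
    obtain e where e: "e < length Bs" "x \<in> Bs ! e" "hd p \<in> Bs ! e"
      using path_decomposition_edge_in_bag[OF pd edge] by (metis in_set_conv_nth insert_subset)
    show ?thesis
    proof (cases "j \<le> e")
      case True
      then have "x \<in> Bs ! j"
        using path_decomposition_bag_convex[OF pd _ True e(1)] Cons.prems(2,3) e(2) by blast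
      then show ?thesis using \<open>w = x\<close> by auto
    next
      case False
      then show ?thesis using Cons.IH[OF tail e(3)] Cons.prems(4) by auto
    qed
  qed
qed

lemma obtain_ordered_triple:
  fixes f :: "'a \<Rightarrow> 'b::linorder"
  assumes "3 \<le> card A"
  obtains x y z where "x \<in> A" "y \<in> A" "z \<in> A" "x \<noteq> y" "y \<noteq> z" "x \<noteq> z" "f x \<le> f y" "f y \<le> f z"
proof -
  have "finite A" "A \<noteq> {}" using assms by (auto intro: card_ge_0_finite)
  then obtain x where x: "x \<in> A" "Min (f ` A) = f x" by (rule obtains_MIN)
  have "2 \<le> card (A - {x})" using assms x(1) \<open>finite A\<close> by simp
  then have "A - {x} \<noteq> {}" by (metis card.empty not_numeral_le_zero)
  then obtain z where z: "z \<in> A - {x}" "Max (f ` (A - {x})) = f z"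
    by (rule obtains_MAX[OF finite_Diff[OF \<open>finite A\<close>]])
  have "1 \<le> card (A - {x} - {z})" using \<open>2 \<le> card (A - {x})\<close> z(1) \<open>finite A\<close> by simp
  then have "A - {x} - {z} \<noteq> {}" by (metis card.empty not_one_le_zero)
  then obtain y where y: "y \<in> A - {x} - {z}" by blast
  have "f x \<le> f y" using Min_le[of "f ` A" "f y"] \<open>finite A\<close> x(2) y by simp
  moreover have "f y \<le> f z" using Max_ge[of "f ` (A - {x})" "f y"] \<open>finite A\<close> z(2) y by simp
  ultimately show thesis using x(1) y z(1) that[of x y z] by blast
qed

text \<open>Of three bags, one for each of three branches, the middle one meets in addition a path that
  joins the two outer branches outside of the middle branch.\<close>

lemma three_branches_large_bag:
  assumes pd: "path_decomposition G Bs" and "finite V"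
    and branches: "3 \<le> card \<X>" "disjoint \<X>" "\<And>X. X \<in> \<X> \<Longrightarrow> X \<subseteq> V"
    and connected: "\<And>X x y. X \<in> \<X> \<Longrightarrow> x \<in> V - X \<Longrightarrow> y \<in> V - X
      \<Longrightarrow> \<exists>p. path_between G x p y \<and> set p \<subseteq> V - X"
    and large: "\<And>X. X \<in> \<X> \<Longrightarrow> \<exists>B\<in>set Bs. Suc n \<le> card (B \<inter> X)"
  shows "\<exists>B\<in>set Bs. Suc (Suc n) \<le> card (B \<inter> V)"
proof -
  have "\<exists>i<length Bs. Suc n \<le> card (Bs ! i \<inter> X)" if "X \<in> \<X>" for X
    using large[OF that] by (auto simp: in_set_conv_nth)
  then obtain f where f: "\<And>X. X \<in> \<X> \<Longrightarrow> f X < length Bs \<and> Suc n \<le> card (Bs ! f X \<inter> X)"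
    by metis
  obtain X Y Z where XYZ: "X \<in> \<X>" "Y \<in> \<X>" "Z \<in> \<X>" "X \<noteq> Y" "Y \<noteq> Z" "X \<noteq> Z"
    and ord: "f X \<le> f Y" "f Y \<le> f Z"
    by (rule obtain_ordered_triple[OF branches(1), of f])
  have "Bs ! f X \<inter> X \<noteq> {}" "Bs ! f Z \<inter> Z \<noteq> {}" using f XYZ by fastforce+
  then obtain x z where "x \<in> Bs ! f X" "x \<in> X" "z \<in> Bs ! f Z" "z \<in> Z" by blast
  moreover have "x \<in> V - Y" "z \<in> V - Y"
    using calculation XYZ branches(2,3) by (auto dest: disjointD)
  then obtain p where "path_between G x p z" "set p \<subseteq> V - Y"
    using connected[OF XYZ(2)] by blast
  ultimately obtain w where w: "w \<in> Bs ! f Y" "w \<in> V - Y"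
    using path_meets_bag_between[OF pd ord(2), of x p z "f X"] f[OF XYZ(3)] ord(1) by blast
  have "finite (Bs ! f Y \<inter> Y)"
    using branches(3)[OF XYZ(2)] \<open>finite V\<close> by (meson finite_Int finite_subset)
  then have "Suc (card (Bs ! f Y \<inter> Y)) = card (insert w (Bs ! f Y \<inter> Y))"
    using w(2) by simp
  also have "\<dots> \<le> card (Bs ! f Y \<inter> V)"
    using w branches(3)[OF XYZ(2)] \<open>finite V\<close> by (intro card_mono) auto
  finally show ?thesis using f[OF XYZ(2)] by (intro bexI[of _ "Bs ! f Y"]) auto
qed

section \<open>Subtrees of the infinite binary tree\<close>

definition heap_graph :: "nat set \<Rightarrow> nat graph" where
  "heap_graph U = (U, {{v, v div 2} | v. v \<in> U \<and> v div 2 \<in> U})"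

definition heap_subtree :: "nat \<Rightarrow> nat set \<Rightarrow> bool" where
  "heap_subtree r U \<longleftrightarrow>
     0 < r \<and> finite U \<and> r \<in> U \<and> (\<forall>v\<in>U. v \<noteq> r \<longrightarrow> r < v \<and> v div 2 \<in> U)"

lemma verts_heap_graph [simp]: "verts (heap_graph U) = U"
  by (simp add: heap_graph_def)

lemma edge_heap_graph_iff:
  "{u, v} \<in> edges (heap_graph U) \<longleftrightarrow> u \<in> U \<and> v \<in> U \<and> (u = v div 2 \<or> v = u div 2)"
  by (auto simp: heap_graph_def doubleton_eq_iff)

lemma edges_heap_graph_mono: "U \<subseteq> V \<Longrightarrow> edges (heap_graph U) \<subseteq> edges (heap_graph V)"
  by (auto simp: heap_graph_def)

lemma heap_subtree_ge: "heap_subtree r U \<Longrightarrow> v \<in> U \<Longrightarrow> r \<le> v"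
  by (cases "v = r") (auto simp: heap_subtree_def)

lemma heap_subtree_induct [consumes 2, case_names root child]:
  assumes "heap_subtree r U" "v \<in> U" "P r"
    and "\<And>v. v \<in> U \<Longrightarrow> r < v \<Longrightarrow> v div 2 \<in> U \<Longrightarrow> P (v div 2) \<Longrightarrow> P v"
  shows "P v"
  using \<open>v \<in> U\<close>
proof (induction v rule: less_induct)
  case (less v)
  show ?case
  proof (cases "v = r")
    case False
    then have "r < v" "v div 2 \<in> U" using assms(1) less.prems by (auto simp: heap_subtree_def)
    then show ?thesis using less assms(4) by simp
  qed (use \<open>P r\<close> in simp)
qed

lemma heap_subtree_singleton: "0 < r \<Longrightarrow> heap_subtree r {r}"
  by (simp add: heap_subtree_def)

lemma heap_subtree_insert_parent:
  assumes "heap_subtree s U" "0 < s div 2"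
  shows "heap_subtree (s div 2) (insert (s div 2) U)"
proof -
  have "s div 2 < v" if "v \<in> U" for v
    using heap_subtree_ge[OF assms(1) that] assms(2) by linarith
  then show ?thesis using assms by (auto simp: heap_subtree_def)
qed

lemma heap_subtree_join:
  assumes "heap_subtree (2 * r) X" "heap_subtree (2 * r + 1) Y"
  shows "heap_subtree r (insert r (X \<union> Y))"
proof -
  have "0 < r" using assms(1) by (simp add: heap_subtree_def)
  then have "heap_subtree r (insert r X)" "heap_subtree r (insert r Y)"
    using heap_subtree_insert_parent[OF assms(1)] heap_subtree_insert_parent[OF assms(2)]
    by simp_all
  then show ?thesis by (auto simp: heap_subtree_def)
qed

lemma heap_subtree_siblings_disjoint:
  assumes X: "heap_subtree (2 * r) X" and Y: "heap_subtree (2 * r + 1) Y"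
  shows "X \<inter> Y = {}"
proof -
  have "v \<notin> Y" if "v \<in> X" for v
    using X that
  proof (induction rule: heap_subtree_induct)
    case root
    then show ?case using heap_subtree_ge[OF Y, of "2 * r"] by auto
  next
    case (child v)
    have "r \<notin> X" using heap_subtree_ge[OF X, of r] X by (auto simp: heap_subtree_def)
    then have "v \<noteq> 2 * r + 1" using child.hyps(3) by auto
    then show ?case using Y child.IH by (auto simp: heap_subtree_def)
  qed
  then show ?thesis by blast
qed

lemma path_from_heap_root:
  assumes "heap_subtree r U" "v \<in> U"
  shows "\<exists>p. path_between (heap_graph U) r p v \<and> set p \<subseteq> {..v} \<and>
    length p + floor_log r = Suc (floor_log v)"
  using assms
proof (induction rule: heap_subtree_induct)
  case root
  show ?case
    using assms(1) by (intro exI[of _ "[r]"]) (simp add: path_between_def heap_subtree_def)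
next
  case (child v)
  then obtain p where p: "path_between (heap_graph U) r p (v div 2)" "set p \<subseteq> {..v div 2}"
    and len: "length p + floor_log r = Suc (floor_log (v div 2))" by blast
  have "2 \<le> v" using child.hyps(2) assms(1) by (simp add: heap_subtree_def)
  then have "v div 2 < v" by simp
  then have "v \<notin> set p" using p(2) by fastforce
  then have "path_between (heap_graph U) r (p @ [v]) v"
    using child.hyps(1,3) by (intro path_between_snoc[OF p(1)]) (simp_all add: edge_heap_graph_iff)
  moreover have "set (p @ [v]) \<subseteq> {..v}" using p(2) \<open>v div 2 < v\<close> by fastforce
  moreover have "length (p @ [v]) + floor_log r = Suc (floor_log v)"
    using len by (simp add: floor_log_rec[OF \<open>2 \<le> v\<close>] del: floor_log_half)
  ultimately show ?case by blast
qed

lemma heap_graph_connected: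
  assumes "heap_subtree r U" "x \<in> U" "y \<in> U"
  shows "\<exists>p. path_between (heap_graph U) x p y"
  using path_from_heap_root[OF assms(1,2)] path_from_heap_root[OF assms(1,3)]
  by (meson path_between_rev path_between_trans)

text \<open>The largest vertex of a cycle would have two distinct smaller neighbours, but its only
  smaller neighbour is its parent.\<close>

lemma heap_graph_acyclic:
  assumes "heap_subtree r U"
  shows "\<not> is_cycle (heap_graph U) c"
proof
  assume cycle: "is_cycle (heap_graph U) c"
  then have "c \<noteq> []" by (auto simp: is_cycle_def)
  then have "Max (set c) \<in> set c" by simp
  then obtain a b where ab: "a \<noteq> b" "a \<in> set c" "b \<in> set c"
    and adjacent: "{Max (set c), a} \<in> edges (heap_graph U)"
      "{Max (set c), b} \<in> edges (heap_graph U)"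
    by (rule cycle_vertex_neighbours[OF cycle])
  have "v = Max (set c) div 2" if "v \<in> set c" "{Max (set c), v} \<in> edges (heap_graph U)" for v
  proof -
    have "v \<le> Max (set c)" using that(1) by simp
    moreover have "v \<noteq> 0"
      using that(2) heap_subtree_ge[OF assms, of v] assms
      by (auto simp: edge_heap_graph_iff heap_subtree_def)
    ultimately show ?thesis using that(2) by (auto simp: edge_heap_graph_iff)
  qed
  then show False using ab adjacent by metis
qed

lemma is_tree_heap_graph:
  assumes "heap_subtree r U"
  shows "is_tree (heap_graph U)"
proof -
  have "card {v, v div 2} = 2" if "v \<in> U" for v
    using heap_subtree_ge[OF assms that] assms by (auto simp: heap_subtree_def card_insert_if)
  then have "finite_simple_graph (heap_graph U)"
    using assms by (auto simp: finite_simple_graph_def heap_graph_def heap_subtree_def)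
  then show ?thesis
    using heap_graph_connected[OF assms] heap_graph_acyclic[OF assms] assms
    by (auto simp: is_tree_def heap_subtree_def)
qed

lemma tree_dist_heap_root:
  assumes "heap_subtree r U" "v \<in> U"
  shows "tree_dist (heap_graph U) r v = floor_log v - floor_log r"
proof -
  obtain p where p: "path_between (heap_graph U) r p v"
    and len: "length p + floor_log r = Suc (floor_log v)"
    using path_from_heap_root[OF assms] by blast
  have "tree_path (heap_graph U) r v = p"
    using is_tree_heap_graph[OF assms(1)] p by (rule tree_path_eqI)
  then show ?thesis using len by (simp add: tree_dist_def)
qed

lemma card_neighbours_heap_graph_le: "card (neighbours (heap_graph U) x) \<le> 3"
proof -
  have "neighbours (heap_graph U) x \<subseteq> {x div 2, 2 * x, 2 * x + 1}"
    by (auto simp: neighbours_def edge_heap_graph_iff)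
  then have "card (neighbours (heap_graph U) x) \<le> card {x div 2, 2 * x, 2 * x + 1}"
    by (intro card_mono) simp_all
  also have "\<dots> \<le> 3" by (simp add: card_insert_if)
  finally show ?thesis .
qed

lemma edges_heap_graph_join_subset:
  assumes X: "heap_subtree (2 * r) X" and Y: "heap_subtree (2 * r + 1) Y"
  shows "edges (heap_graph (insert r (X \<union> Y))) \<subseteq>
    edges (heap_graph X) \<union> {{r, v} | v. v \<in> X} \<union> {{r, 2 * r + 1}} \<union> edges (heap_graph Y)"
proof
  fix e assume "e \<in> edges (heap_graph (insert r (X \<union> Y)))"
  then obtain v where e: "e = {v, v div 2}" "v \<in> insert r (X \<union> Y)" "v div 2 \<in> insert r (X \<union> Y)"
    by (auto simp: heap_graph_def)
  have sub: "heap_subtree r (insert r (X \<union> Y))" using X Y by (rule heap_subtree_join)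
  then have "r \<le> v div 2" "0 < r" using heap_subtree_ge[OF _ e(3)] by (auto simp: heap_subtree_def)
  then have "v \<noteq> r" by auto
  then consider "v = 2 * r" | "v \<in> X" "v div 2 \<in> X" | "v = 2 * r + 1" | "v \<in> Y" "v div 2 \<in> Y"
    using e(2) X Y by (auto simp: heap_subtree_def)
  then show "e \<in> edges (heap_graph X) \<union> {{r, v} | v. v \<in> X} \<union> {{r, 2 * r + 1}}
      \<union> edges (heap_graph Y)"
    using X e(1) by cases (auto simp: heap_graph_def heap_subtree_def insert_commute)
qed

lemma path_decomposition_heap_join:
  assumes X: "heap_subtree (2 * r) X" and Y: "heap_subtree (2 * r + 1) Y"
    and Bs: "path_decomposition (heap_graph X) Bs"
    and Cs: "path_decomposition (heap_graph Y) Cs" "2 * r + 1 \<in> hd Cs"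
  shows "path_decomposition (heap_graph (insert r (X \<union> Y)))
    (map (insert r) Bs @ [{r, 2 * r + 1}] @ Cs)"
proof -
  have r: "0 < r" "2 * r \<in> X" "2 * r + 1 \<in> Y" using X Y by (auto simp: heap_subtree_def)
  have r_less: "r < v" if "v \<in> X \<union> Y" for v
    using that heap_subtree_ge[OF X, of v] heap_subtree_ge[OF Y, of v] \<open>0 < r\<close> by fastforce
  let ?GX = "(insert r X, edges (heap_graph X) \<union> {{r, v} | v. v \<in> X})"
  let ?GY = "({r, 2 * r + 1} \<union> Y, {{r, 2 * r + 1}} \<union> edges (heap_graph Y))"
  have "Bs \<noteq> []" using path_decomposition_Union[OF Bs] r(2) by auto
  then have "path_decomposition ?GX (map (insert r) Bs)"
    using path_decomposition_insert[OF Bs, of r] by simp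
  moreover have "path_decomposition ?GY ([{r, 2 * r + 1}] @ Cs)"
    using path_decomposition_append[OF path_decomposition_trivial Cs(1),
        of "({r, 2 * r + 1}, {{r, 2 * r + 1}})"] Cs(2) r_less
    by auto
  moreover have "verts ?GX \<inter> verts ?GY
      \<subseteq> last (map (insert r) Bs) \<inter> hd ([{r, 2 * r + 1}] @ Cs)"
    using heap_subtree_siblings_disjoint[OF X Y] r(3) \<open>Bs \<noteq> []\<close> by (auto simp: last_map)
  ultimately have join: "path_decomposition (verts ?GX \<union> verts ?GY, edges ?GX \<union> edges ?GY)
      (map (insert r) Bs @ [{r, 2 * r + 1}] @ Cs)"
    by (rule path_decomposition_append)
  have "edges (heap_graph (insert r (X \<union> Y))) \<subseteq> edges ?GX \<union> edges ?GY"
    using edges_heap_graph_join_subset[OF X Y] by (simp add: Un_assoc)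
  then show ?thesis using r(3) by (intro path_decomposition_mono_edges[OF join]) auto
qed

section \<open>Iterated combs\<close>

text \<open>The vertex \<open>r\<close> starts a backbone of length \<open>l\<close> running to right children; the left child
  of every backbone vertex but the last is the root of a copy of the comb of level \<open>k - 1\<close> with
  backbone length \<open>L\<close>.\<close>

fun comb :: "nat \<Rightarrow> nat \<Rightarrow> nat \<Rightarrow> nat \<Rightarrow> nat set" where
  "comb L 0 l r = {r}"
| "comb L (Suc k) 0 r = {r}"
| "comb L (Suc k) (Suc l) r = insert r (comb L k L (2 * r) \<union> comb L (Suc k) l (2 * r + 1))"

primrec teeth :: "nat \<Rightarrow> nat \<Rightarrow> nat \<Rightarrow> nat \<Rightarrow> nat set set" where
  "teeth L k 0 r = {}"
| "teeth L k (Suc l) r = insert (comb L k L (2 * r)) (teeth L k l (2 * r + 1))"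

lemma finite_comb [simp]: "finite (comb L k l r)"
  by (induction L k l r rule: comb.induct) simp_all

lemma heap_subtree_comb: "0 < r \<Longrightarrow> heap_subtree r (comb L k l r)"
proof (induction L k l r rule: comb.induct)
  case (3 L k l r)
  then show ?case unfolding comb.simps by (intro heap_subtree_join) simp_all
qed (simp_all add: heap_subtree_singleton)

lemma floor_log_comb_le: "v \<in> comb L k l r \<Longrightarrow> 0 < r \<Longrightarrow> floor_log v \<le> floor_log r + k * L + l"
proof (induction L k l r rule: comb.induct)
  case (3 L k l r)
  have "floor_log (2 * r + 1) = Suc (floor_log r)"
    using floor_log_rec[of "2 * r + 1"] \<open>0 < r\<close> by simp
  then show ?case using 3 by fastforce
qed simp_all

lemma teeth_are_combs: "X \<in> teeth L k l r \<Longrightarrow> 0 < r \<Longrightarrow> \<exists>s>0. X = comb L k L s"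
proof (induction l arbitrary: r)
  case (Suc l)
  then consider "X = comb L k L (2 * r)" | "X \<in> teeth L k l (2 * r + 1)" by auto
  then show ?case
  proof cases
    case 1
    then show ?thesis using Suc.prems(2) by (intro exI[of _ "2 * r"]) simp
  next
    case 2
    then show ?thesis by (rule Suc.IH) simp
  qed
qed simp

lemma tooth_subset_comb: "X \<in> teeth L k l r \<Longrightarrow> X \<subseteq> comb L (Suc k) l r"
  by (induction l arbitrary: r) (simp, simp, blast)

lemma comb_siblings_disjoint:
  "0 < r \<Longrightarrow> comb L k l (2 * r) \<inter> comb L' k' l' (2 * r + 1) = {}"
  by (rule heap_subtree_siblings_disjoint[of r]) (simp_all add: heap_subtree_comb)

lemma disjnt_comb_later_tooth:
  "0 < r \<Longrightarrow> Y \<in> teeth L k l (2 * r + 1) \<Longrightarrow> disjnt (comb L k L (2 * r)) Y"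
  using comb_siblings_disjoint tooth_subset_comb unfolding disjnt_def by blast

lemma disjoint_teeth: "0 < r \<Longrightarrow> disjoint (teeth L k l r)"
proof (induction l arbitrary: r)
  case (Suc l)
  then have "disjoint (teeth L k l (2 * r + 1))" by simp
  then show ?case
    using disjnt_comb_later_tooth[OF Suc.prems] by (auto simp: pairwise_insert disjnt_sym)
qed simp

lemma finite_teeth [simp]: "finite (teeth L k l r)"
  by (induction l arbitrary: r) simp_all

lemma card_teeth: "0 < r \<Longrightarrow> card (teeth L k l r) = l"
proof (induction l arbitrary: r)
  case (Suc l)
  have "comb L k L (2 * r) \<noteq> {}"
    using heap_subtree_comb[of "2 * r" L k L] Suc.prems by (auto simp: heap_subtree_def)
  then have "comb L k L (2 * r) \<notin> teeth L k l (2 * r + 1)"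
    using disjnt_comb_later_tooth[OF Suc.prems] by (metis disjnt_self_iff_empty)
  then show ?case using Suc by simp
qed simp

lemma heap_subtree_diff_tooth:
  "X \<in> teeth L k l r \<Longrightarrow> 0 < r \<Longrightarrow> heap_subtree r (comb L (Suc k) l r - X)"
proof (induction l arbitrary: r)
  case (Suc l)
  let ?X = "comb L k L (2 * r)" and ?Y = "comb L (Suc k) l (2 * r + 1)"
  have sub: "heap_subtree (2 * r) ?X" "heap_subtree (2 * r + 1) ?Y"
    using Suc.prems(2) by (simp_all add: heap_subtree_comb)
  have disj: "?X \<inter> ?Y = {}" using Suc.prems(2) by (rule comb_siblings_disjoint)
  have r: "r \<notin> ?X" "r \<notin> ?Y"
    using heap_subtree_ge[OF sub(1), of r] heap_subtree_ge[OF sub(2), of r] Suc.prems(2) by auto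
  consider "X = ?X" | "X \<in> teeth L k l (2 * r + 1)" using Suc.prems(1) by auto
  then show ?case
  proof cases
    case 1
    then have "comb L (Suc k) (Suc l) r - X = insert r ?Y" using r disj by auto
    then show ?thesis using heap_subtree_insert_parent[OF sub(2)] Suc.prems(2) by simp
  next
    case 2
    then have "X \<subseteq> ?Y" by (rule tooth_subset_comb)
    then have "comb L (Suc k) (Suc l) r - X = insert r (?X \<union> (?Y - X))"
      using r disj by auto
    then show ?thesis using heap_subtree_join[OF sub(1) Suc.IH[OF 2]] by simp
  qed
qed simp

lemma card_comb_ge: "0 < r \<Longrightarrow> L ^ k \<le> card (comb L k L r)"
proof (induction k arbitrary: r)
  case (Suc k)
  have "L ^ Suc k = (\<Sum>X\<in>teeth L k L r. L ^ k)"
    using card_teeth[OF Suc.prems] by simp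
  also have "\<dots> \<le> sum card (teeth L k L r)"
    using teeth_are_combs Suc by (intro sum_mono) blast
  also have "\<dots> = card (\<Union>(teeth L k L r))"
    using disjoint_teeth[OF Suc.prems] teeth_are_combs[OF _ Suc.prems] finite_comb
    by (intro card_Union_disjoint[symmetric]) blast+
  also have "\<dots> \<le> card (comb L (Suc k) L r)"
    using tooth_subset_comb by (intro card_mono Union_least finite_comb) blast
  finally show ?case .
qed simp

lemma path_decomposition_heap_trivial: "path_decomposition (heap_graph U) [U]"
  using path_decomposition_trivial[of "heap_graph U"] by (auto simp: heap_graph_def)

lemma ex_path_decomposition_comb:
  "0 < r \<Longrightarrow> \<exists>Bs. path_decomposition (heap_graph (comb L k l r)) Bs \<and>
    (\<forall>B\<in>set Bs. card B \<le> Suc k) \<and> r \<in> hd Bs"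
proof (induction L k l r rule: comb.induct)
  case (3 L k l r)
  obtain Bs where Bs: "path_decomposition (heap_graph (comb L k L (2 * r))) Bs"
    "\<forall>B\<in>set Bs. card B \<le> Suc k" "2 * r \<in> hd Bs" using 3 by fastforce
  obtain Cs where Cs: "path_decomposition (heap_graph (comb L (Suc k) l (2 * r + 1))) Cs"
    "\<forall>C\<in>set Cs. card C \<le> Suc (Suc k)" "2 * r + 1 \<in> hd Cs" using 3 by fastforce
  let ?Ds = "map (insert r) Bs @ [{r, 2 * r + 1}] @ Cs"
  have "path_decomposition (heap_graph (comb L (Suc k) (Suc l) r)) ?Ds"
    unfolding comb.simps
    using Bs(1) Cs(1,3) \<open>0 < r\<close>
    by (intro path_decomposition_heap_join) (simp_all add: heap_subtree_comb)
  moreover have "card D \<le> Suc (Suc k)" if "D \<in> set ?Ds" for D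
    using that Bs(2) Cs(2) by (auto intro!: card_insert_le_m1)
  moreover have "r \<in> hd ?Ds" by (cases Bs) auto
  ultimately show ?case by blast
next
  case (1 L l r)
  then show ?case using path_decomposition_heap_trivial by (intro exI[of _ "[{r}]"]) simp
next
  case (2 L k r)
  then show ?case using path_decomposition_heap_trivial by (intro exI[of _ "[{r}]"]) simp
qed

lemma comb_large_bag:
  assumes "path_decomposition (heap_graph U) Bs" "3 \<le> L"
  shows "0 < r \<Longrightarrow> comb L k L r \<subseteq> U \<Longrightarrow> \<exists>B\<in>set Bs. Suc k \<le> card (B \<inter> comb L k L r)"
proof (induction k arbitrary: r)
  case 0
  then obtain B where "B \<in> set Bs" "r \<in> B" using path_decomposition_Union[OF assms(1)] by auto
  then show ?case by (intro bexI[of _ B]) auto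
next
  case (Suc k)
  let ?V = "comb L (Suc k) L r"
  show ?case
  proof (rule three_branches_large_bag[OF assms(1)])
    show "finite ?V" by simp
    show "3 \<le> card (teeth L k L r)" "disjoint (teeth L k L r)"
      using card_teeth[OF Suc.prems(1)] disjoint_teeth[OF Suc.prems(1)] assms(2) by simp_all
    fix X assume X: "X \<in> teeth L k L r"
    show "X \<subseteq> ?V" using X by (rule tooth_subset_comb)
    then show "\<exists>B\<in>set Bs. Suc k \<le> card (B \<inter> X)"
      using teeth_are_combs[OF X Suc.prems(1)] Suc.IH Suc.prems(2) by (metis order.trans)
    fix x y assume "x \<in> ?V - X" "y \<in> ?V - X"
    then obtain p where p: "path_between (heap_graph (?V - X)) x p y"
      using heap_graph_connected[OF heap_subtree_diff_tooth[OF X Suc.prems(1)]] by blast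
    have "?V - X \<subseteq> U" using Suc.prems(2) by blast
    then have "path_between (heap_graph U) x p y"
      by (intro path_between_mono[OF p] edges_heap_graph_mono) simp_all
    moreover have "set p \<subseteq> ?V - X" using p by (simp add: path_between_def)
    ultimately show "\<exists>p. path_between (heap_graph U) x p y \<and> set p \<subseteq> ?V - X" by blast
  qed
qed

lemma pathwidth_comb:
  assumes "3 \<le> L" "0 < r"
  shows "pathwidth (heap_graph (comb L k L r)) = k"
proof -
  let ?U = "comb L k L r"
  obtain Bs where "path_decomposition (heap_graph ?U) Bs" "\<forall>B\<in>set Bs. card B \<le> Suc k"
    using ex_path_decomposition_comb[OF assms(2)] by blast
  moreover have "\<exists>C\<in>set Cs. Suc k \<le> card C" if Cs: "path_decomposition (heap_graph ?U) Cs" for Cs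
  proof -
    obtain C where C: "C \<in> set Cs" "Suc k \<le> card (C \<inter> ?U)"
      using comb_large_bag[OF Cs assms(1,2) order.refl] by blast
    moreover have "C \<subseteq> ?U" using C(1) path_decomposition_Union[OF Cs] by auto
    ultimately show ?thesis by (metis inf.absorb1)
  qed
  ultimately show ?thesis by (intro pathwidth_eqI) blast+
qed

section \<open>The lower bound\<close>

definition has_hard_instance ::
    "'r measure \<Rightarrow> ('r, 'v) algorithm \<Rightarrow> real \<Rightarrow> nat \<Rightarrow> nat \<Rightarrow> bool" where
  "has_hard_instance M A c k D \<longleftrightarrow>
     (\<exists>T s t. is_tree T \<and> pathwidth T = k \<and> s \<in> verts T \<and> t \<in> verts T \<and> D \<le> tree_dist T s t \<and>
        ennreal (c * (real k * ln (real (tree_dist T s t)))) \<le> expected_queries M A T s t)"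

lemma card_floor_log_ge:
  assumes "finite U"
  shows "card U \<le> card {v \<in> U. D \<le> floor_log v} + 2 ^ D"
proof -
  have "v < 2 ^ D" if "floor_log v < D" for v
  proof -
    have "v < 2 ^ Suc (floor_log v)" using floor_log_exp2_gt[of v] by simp
    also have "\<dots> \<le> 2 ^ D" using that by (intro power_increasing) simp_all
    finally show ?thesis .
  qed
  then have "U \<subseteq> {v \<in> U. D \<le> floor_log v} \<union> {..<2 ^ D}" using leI by blast
  then have "card U \<le> card ({v \<in> U. D \<le> floor_log v} \<union> {..<2 ^ D})"
    using assms by (intro card_mono) auto
  also have "\<dots> \<le> card {v \<in> U. D \<le> floor_log v} + card {..<(2::nat) ^ D}"
    by (rule card_Un_le)
  finally show ?thesis by simp
qed

lemma card_deep_comb_ge: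
  assumes "1 \<le> k" "0 < r" "2 * 2 ^ D \<le> L"
  shows "L ^ k \<le> 2 * card {v \<in> comb L k L r. D \<le> floor_log v}"
proof -
  have "L ^ k \<le> card (comb L k L r)" using assms(2) by (rule card_comb_ge)
  also have "\<dots> \<le> card {v \<in> comb L k L r. D \<le> floor_log v} + 2 ^ D"
    by (rule card_floor_log_ge) simp
  finally have "L ^ k \<le> card {v \<in> comb L k L r. D \<le> floor_log v} + 2 ^ D" .
  moreover have "1 \<le> L" using assms(3) by (cases L) simp_all
  then have "2 * 2 ^ D \<le> L ^ k" using self_le_power[of L k] assms(1,3) by simp
  ultimately show ?thesis by simp
qed

lemma mult_ln_le_log4:
  fixes k n d L :: nat
  assumes "1 \<le> k" "4 \<le> L" "L ^ k \<le> 2 * n" "0 < d" "d \<le> L\<^sup>2"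
  shows "real k * ln (real d) / 8 \<le> log 4 (real n)"
proof -
  have L: "4 \<le> real L" using assms(2) by simp
  then have "0 < real L ^ k" by (intro zero_less_power) linarith
  moreover have power: "real L ^ k \<le> 2 * real n"
    using assms(3) by (metis of_nat_le_iff of_nat_mult of_nat_numeral of_nat_power)
  ultimately have n: "0 < real n" by linarith
  with power \<open>0 < real L ^ k\<close> have "ln (real L ^ k) \<le> ln (2 * real n)"
    by (subst ln_le_cancel_iff) simp_all
  then have "real k * ln (real L) \<le> ln 2 + ln (real n)"
    using L n by (simp add: ln_realpow ln_mult)
  moreover have ln4: "ln 4 = 2 * ln (2::real)" using ln_realpow[of 2 2] by simp
  moreover have "1 * ln 4 \<le> real k * ln (real L)"
    using assms(1) L by (intro mult_mono) simp_all
  ultimately have "real k * ln (real L) \<le> 2 * ln (real n)" by simp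
  moreover have "real k * ln (real d) \<le> real k * (2 * ln (real L))"
  proof -
    have "real d \<le> real L ^ 2" using assms(5) by (metis of_nat_le_iff of_nat_power)
    then have "ln (real d) \<le> ln (real L ^ 2)" using assms(4) L by simp
    also have "\<dots> = 2 * ln (real L)" using L by (simp add: ln_realpow)
    finally show ?thesis by (rule mult_left_mono) simp
  qed
  ultimately have "real k * ln (real d) / 8 \<le> ln (real n) / 2" by simp
  also have "\<dots> \<le> ln (real n) / ln 4"
  proof (rule divide_left_mono)
    show "ln 4 \<le> (2::real)" using ln4 ln_le_minus_one[of "2::real"] by simp
    show "0 \<le> ln (real n)" using n by simp
  qed simp
  finally show ?thesis by (simp add: log_def)
qed

lemma zero_error_algorithm_has_hard_instance:
  fixes A :: "('r, nat) algorithm"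
  assumes alg: "zero_error_algorithm M A" and k: "1 \<le> k"
  shows "has_hard_instance M A (1 / 8) k D"
proof -
  define L where "L = 3 + k + 2 ^ Suc (Suc D)"
  define U where "U = comb L k L 1"
  define S where "S = {v \<in> U. Suc D \<le> floor_log v}"
  let ?T = "heap_graph U"
  have sub: "heap_subtree 1 U" unfolding U_def by (simp add: heap_subtree_comb)
  then have tree: "is_tree ?T" by (rule is_tree_heap_graph)
  have root: "1 \<in> verts ?T" using sub by (simp add: heap_subtree_def)
  have card: "L ^ k \<le> 2 * card S"
    unfolding S_def U_def using k by (intro card_deep_comb_ge) (simp_all add: L_def)
  have "0 < L ^ k" by (simp add: L_def)
  then have "S \<noteq> {}" using card by (metis card.empty mult_0_right not_le)
  moreover have "S \<subseteq> verts ?T" by (auto simp: S_def)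
  ultimately have "\<exists>t\<in>S. ennreal (log 4 (real (card S))) \<le> expected_queries M A ?T 1 t"
    using exists_expected_queries_ge[OF alg tree root card_neighbours_heap_graph_le, of S] by simp
  then obtain t where t: "t \<in> S"
    and queries: "ennreal (log 4 (real (card S))) \<le> expected_queries M A ?T 1 t" by blast
  have "t \<in> U" and far: "Suc D \<le> floor_log t" using t by (simp_all add: S_def)
  have dist: "tree_dist ?T 1 t = floor_log t"
    using tree_dist_heap_root[OF sub \<open>t \<in> U\<close>] by simp
  have "floor_log t \<le> (k + 1) * L"
    using floor_log_comb_le[of t L k L 1] \<open>t \<in> U\<close> by (simp add: U_def)
  also have "\<dots> \<le> L\<^sup>2" unfolding power2_eq_square by (rule mult_le_mono1) (simp add: L_def)
  finally have "real k * ln (real (floor_log t)) / 8 \<le> log 4 (real (card S))"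
    using k card far by (intro mult_ln_le_log4) (simp_all add: L_def)
  then have "1 / 8 * (real k * ln (real (tree_dist ?T 1 t))) \<le> log 4 (real (card S))"
    unfolding dist by simp
  then have "ennreal (1 / 8 * (real k * ln (real (tree_dist ?T 1 t))))
      \<le> expected_queries M A ?T 1 t"
    using queries by (meson ennreal_leI order.trans)
  moreover have "pathwidth ?T = k" unfolding U_def by (rule pathwidth_comb) (simp_all add: L_def)
  moreover have "t \<in> verts ?T" using \<open>t \<in> U\<close> by simp
  moreover have "D \<le> tree_dist ?T 1 t" unfolding dist using far by simp
  ultimately show ?thesis unfolding has_hard_instance_def using tree root by blast
qed

lemma eventually_prod_at_topE:
  fixes R :: "'a \<times> 'b::linorder \<Rightarrow> bool"
  assumes "eventually R (K \<times>\<^sub>F at_top)" "K \<noteq> bot" "eventually S K"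
  obtains k D where "S k" "\<forall>d\<ge>D. R (k, d)"
proof -
  obtain P Q where P: "eventually P K" and Q: "eventually Q at_top"
    and PQ: "\<And>k d. P k \<Longrightarrow> Q d \<Longrightarrow> R (k, d)"
    using assms(1) unfolding eventually_prod_filter by blast
  obtain k where "P k" "S k"
    using eventually_happens[OF eventually_conj[OF P assms(3)]] assms(2) by blast
  moreover obtain D where "\<forall>d\<ge>D. Q d" using Q by (auto simp: eventually_at_top_linorder)
  ultimately show thesis using that PQ by blast
qed

lemma complexity_little_oE:
  fixes K :: "nat filter"
  assumes "complexity_little_o_k_log_dist M A (K \<times>\<^sub>F at_top)"
    and K: "K \<noteq> bot" "\<forall>\<^sub>F k in K. 1 \<le> k" and "0 < c"
  obtains k D where "1 \<le> k"
    and "\<forall>T s t.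
      is_tree T \<and> pathwidth T = k \<and> s \<in> verts T \<and> t \<in> verts T \<and> D \<le> tree_dist T s t \<longrightarrow>
      expected_queries M A T s t \<le> ennreal (c * (real k * ln (real (tree_dist T s t))))"
proof -
  define bounded_by where "bounded_by k d b \<longleftrightarrow> (\<forall>T s t.
      is_tree T \<and> pathwidth T = k \<and> s \<in> verts T \<and> t \<in> verts T \<and> tree_dist T s t = d \<longrightarrow>
      expected_queries M A T s t \<le> ennreal b)" for k d b
  obtain g :: "nat \<times> nat \<Rightarrow> real"
    where g: "g \<in> o[K \<times>\<^sub>F at_top](\<lambda>(k, d). real k * ln (real d))"
      and bound: "\<forall>\<^sub>F (k, d) in K \<times>\<^sub>F at_top. bounded_by k d (g (k, d))"
    using assms(1) unfolding complexity_little_o_k_log_dist_def bounded_by_def by blast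
  have "\<forall>\<^sub>F x in K \<times>\<^sub>F at_top.
      norm (g x) \<le> c * norm (case x of (k, d) \<Rightarrow> real k * ln (real d))"
    using landau_o.smallD[OF g \<open>0 < c\<close>] by simp
  from eventually_conj[OF bound this] K obtain k D where "1 \<le> k"
    and at_k: "\<forall>d\<ge>D. bounded_by k d (g (k, d)) \<and> \<bar>g (k, d)\<bar> \<le> c * \<bar>real k * ln (real d)\<bar>"
    unfolding prod.case real_norm_def by (rule eventually_prod_at_topE) auto
  have "expected_queries M A T s t \<le> ennreal (c * (real k * ln (real (tree_dist T s t))))"
    if T: "is_tree T \<and> pathwidth T = k \<and> s \<in> verts T \<and> t \<in> verts T \<and> D \<le> tree_dist T s t"
    for T s t
  proof -
    let ?d = "tree_dist T s t"
    have at_kd: "bounded_by k ?d (g (k, ?d)) \<and> \<bar>g (k, ?d)\<bar> \<le> c * \<bar>real k * ln (real ?d)\<bar>"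
      using at_k T by blast
    then have "expected_queries M A T s t \<le> ennreal (g (k, ?d))"
      using T unfolding bounded_by_def by blast
    moreover have "0 \<le> real k * ln (real ?d)" by (cases ?d) simp_all
    then have "g (k, ?d) \<le> c * (real k * ln (real ?d))"
      using at_kd by linarith
    ultimately show ?thesis by (meson ennreal_leI order.trans)
  qed
  then show thesis using that \<open>1 \<le> k\<close> by blast
qed

lemma not_complexity_little_oI:
  fixes K :: "nat filter"
  assumes K: "K \<noteq> bot" "\<forall>\<^sub>F k in K. 1 \<le> k" and "0 < c"
    and hard: "\<And>k D. 1 \<le> k \<Longrightarrow> has_hard_instance M A c k D"
  shows "\<not> complexity_little_o_k_log_dist M A (K \<times>\<^sub>F at_top)"
proof
  assume little_o: "complexity_little_o_k_log_dist M A (K \<times>\<^sub>F at_top)"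
  have "0 < c / 2" using \<open>0 < c\<close> by simp
  from little_o K this obtain k D where "1 \<le> k"
    and upper: "\<forall>T s t.
      is_tree T \<and> pathwidth T = k \<and> s \<in> verts T \<and> t \<in> verts T \<and> D \<le> tree_dist T s t \<longrightarrow>
      expected_queries M A T s t \<le> ennreal (c / 2 * (real k * ln (real (tree_dist T s t))))"
    by (rule complexity_little_oE)
  obtain T s t where T: "is_tree T" "pathwidth T = k" "s \<in> verts T" "t \<in> verts T"
    and far: "max D 2 \<le> tree_dist T s t"
    and lower: "ennreal (c * (real k * ln (real (tree_dist T s t)))) \<le> expected_queries M A T s t"
    using hard[OF \<open>1 \<le> k\<close>, of "max D 2"] unfolding has_hard_instance_def by blast
  have "0 < real k * ln (real (tree_dist T s t))" using \<open>1 \<le> k\<close> far by simp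
  then have "ennreal (c / 2 * (real k * ln (real (tree_dist T s t))))
      < ennreal (c * (real k * ln (real (tree_dist T s t))))"
    using \<open>0 < c\<close>
    by (intro ennreal_lessI mult_strict_right_mono mult_pos_pos[OF \<open>0 < c\<close>]) simp_all
  moreover have "expected_queries M A T s t
      \<le> ennreal (c / 2 * (real k * ln (real (tree_dist T s t))))"
    using upper T far max.boundedE by blast
  ultimately show False using lower by simp
qed

theorem theorem3:
  fixes M :: "'r measure" and K :: "nat filter"
  assumes "K \<noteq> bot" and "\<forall>\<^sub>F k in K. 1 \<le> k"
  shows "\<not> (\<exists>A :: ('r, nat) algorithm.
           zero_error_algorithm M A \<and>
           complexity_little_o_k_log_dist M A (K \<times>\<^sub>F at_top))"
proof
  assume "\<exists>A :: ('r, nat) algorithm.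
    zero_error_algorithm M A \<and> complexity_little_o_k_log_dist M A (K \<times>\<^sub>F at_top)"
  then obtain A :: "('r, nat) algorithm" where alg: "zero_error_algorithm M A"
    and little_o: "complexity_little_o_k_log_dist M A (K \<times>\<^sub>F at_top)" by blast
  have "has_hard_instance M A (1 / 8) k D" if "1 \<le> k" for k D
    using alg that by (rule zero_error_algorithm_has_hard_instance)
  then have "\<not> complexity_little_o_k_log_dist M A (K \<times>\<^sub>F at_top)"
    using assms by (intro not_complexity_little_oI[where c = "1 / 8"]) simp_all
  with little_o show False by contradiction
qed

end
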